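(* Let $G$ be a group, let $\mu,\chi:G\to\mathbb{C}^*$ be different characters of $G$ and let $A:G\to\mathbb{C}$ be a nonzero additive function. The solutions $f,g_1,h_1,h_2,h:G\to\mathbb{C}$ of the functional equation $$f(xy)=g_1(x)h_1(y)+\mu(x)h_2(y)+\chi(x)A(x)h(y)\quad\text{for all }x,y\in G$$ are exactly the quintuples $(f,g_1,h_1,h_2,h)$ of one of the following forms: (1) $f=a\mu$, $g_1$ arbitrary, $h_1=0$, $h_2=a\mu$ and $h=0$, where $a$ ranges over $\mathbb{C}$; (2) $f=a\mu$, $g_1=-b\mu+c\chi A$, $h_1\neq 0$ arbitrary, $h_2=a\mu+bh_1$ and $h=-ch_1$, where $a,b,c$ range over $\mathbb{C}$; (3) $f=a\mu+b\chi A$, $g_1=\alpha\mu+\beta\chi+\gamma\chi A$, $h_1=c\chi A$, $h_2=a\mu-\alpha c\chi A$ and $h=b\chi-\gamma c\chi A$, where $a,\alpha,\beta,\gamma,b,c\in\mathbb{C}$ are constants such that $\beta bc\neq 0$ and $b=\beta c$; (4) $f=a_1\mu+\varphi_{\mu_1,\mu}$, $g_1=(\varphi_{\mu_1,\mu}-a_2\mu)/a+a_3\chi A$, $h_1=a\mu_1$, $h_2=a_1\mu+a_2\mu_1+\varphi_{\mu_1,\mu}$ and $h=-aa_3\mu_1$, where $\mu_1$ is a character of $G$, $a_1,a_2,a_3$ range over $\mathbb{C}$, $a$ ranges over $\mathbb{C}\setminus\{0\}$, and $\varphi_{\mu_1,\mu}:G\to\mathbb{C}$ is a solution of $\varphi_{\mu_1,\mu}(xy)=\varphi_{\mu_1,\mu}(x)\mu_1(y)+\mu(x)\varphi_{\mu_1,\mu}(y)$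 for all $x,y\in G$; (5) $f=a\mu+ca_2\chi+\alpha ca_2\chi A$, $g_1=a_1\mu+a_2\chi+a_3\chi A$, $h_1=c\chi+\alpha c\chi A$, $h_2=a\mu-ca_1\chi-\alpha ca_1\chi A$ and $h=c(\alpha a_2-a_3)\chi-\alpha ca_3\chi A$, where $\alpha,a,a_1,a_3$ range over $\mathbb{C}$, and $c$ and $a_2$ over $\mathbb{C}\setminus\{0\}$.
   Context: A character of a group $G$ is a homomorphism from $G$ into the multiplicative group $\mathbb{C}^*$ of nonzero complex numbers. A function $A:G\to\mathbb{C}$ is additive if $A(xy)=A(x)+A(y)$ for all $x,y\in G$. $\chi A$ denotes the pointwise product. "Arbitrary" means an arbitrary function $G\to\mathbb{C}$; $h_1\neq 0$ means that $h_1$ is not the zero function. Within a given form, $\varphi_{\mu_1,\mu}$ denotes one and the same function at each occurrence. *)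

theory Defs
  imports Complex_Main "HOL-Algebra.Group"
begin

definition complex_mult_group :: "complex monoid" where
  "complex_mult_group = \<lparr>carrier = UNIV - {0}, mult = (*), one = 1\<rparr>"

text \<open>Functions on a group are rendered as functions on the underlying type; only their values on
  the carrier are meaningful, so functions are compared and properties required on the carrier only.\<close>

definition character :: "('a, 'b) monoid_scheme \<Rightarrow> ('a \<Rightarrow> complex) \<Rightarrow> bool" where
  "character G \<chi> \<longleftrightarrow> \<chi> \<in> hom G complex_mult_group"

definition additive_on_group :: "('a, 'b) monoid_scheme \<Rightarrow> ('a \<Rightarrow> complex) \<Rightarrow> bool" where
  "additive_on_group G A \<longleftrightarrow> (\<forall>x\<in>carrier G. \<forall>y\<in>carrier G. A (x \<otimes>\<^bsub>G\<^esub> y) = A x + A y)"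

end

theory Submission
  imports Defs
begin

text \<open>If \<open>g\<^sub>1\<close> lies in the span of \<open>\<mu>, \<chi>, \<chi> A\<close>, everything follows by comparing
  coefficients, since \<open>\<mu>, \<chi>, \<chi> A\<close> are linearly independent. Otherwise \<open>g\<^sub>1, \<mu>, \<chi>, \<chi> A\<close>
  are linearly independent; expanding \<open>f (x y z)\<close> in two ways and comparing coefficients of
  \<open>\<chi>(x)\<close> forces \<open>h\<close> to be a multiple of \<open>h\<^sub>1\<close>. The term \<open>\<chi> A h\<close> is then absorbed into \<open>g\<^sub>1 h\<^sub>1\<close>,
  and in the remaining equation \<open>f (x y) = g x h\<^sub>1 y + \<mu> x h\<^sub>2 y\<close> the same expansion makes \<open>h\<^sub>1\<close>
  proportional to a character.\<close>

section \<open>Characters and the equation with two terms\<close>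

lemma characterD:
  assumes "character G \<chi>"
  shows "x \<in> carrier G \<Longrightarrow> \<chi> x \<noteq> 0"
    and "\<lbrakk>x \<in> carrier G; y \<in> carrier G\<rbrakk> \<Longrightarrow> \<chi> (x \<otimes>\<^bsub>G\<^esub> y) = \<chi> x * \<chi> y"
  using assms by (auto simp: character_def complex_mult_group_def hom_def)

context group
begin

lemma character_one:
  assumes "character G m"
  shows "m \<one> = 1"
  using characterD[OF assms, of \<one>] characterD(2)[OF assms, of \<one> \<one>] by simp

text \<open>The value 1 at the identity excludes the zero map: \<open>m x * m (inv x) = 1\<close>
  makes every value nonzero.\<close>

lemma characterI:
  assumes mult: "\<And>x y. \<lbrakk>x \<in> carrier G; y \<in> carrier G\<rbrakk> \<Longrightarrow> m (x \<otimes> y) = m x * m y"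
    and one: "m \<one> = 1"
  shows "character G m"
proof -
  have "m x \<noteq> 0" if "x \<in> carrier G" for x
    using mult[of x "inv x"] one that by auto
  then show ?thesis
    using mult by (auto simp: character_def complex_mult_group_def hom_def)
qed

text \<open>Putting \<open>y = \<one>\<close> gives \<open>f = a * g + b * \<mu>\<close>, so
  \<open>f\<close> can be eliminated. Since \<open>indep\<close> says that \<open>g\<close> is not a
  multiple of \<open>\<mu>\<close>, coefficients of \<open>g\<close> may be compared, which makes
  \<open>k / a\<close> multiplicative.\<close>

lemma two_term_equation:
  assumes \<mu>: "character G \<mu>"
    and eq: "\<And>x y. \<lbrakk>x \<in> carrier G; y \<in> carrier G\<rbrakk> \<Longrightarrow> f (x \<otimes> y) = g x * k y + \<mu> x * l y"
    and indep: "\<And>p q. (\<And>x. x \<in> carrier G \<Longrightarrow> p * g x + q * \<mu> x = 0) \<Longrightarrow> p = 0"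
    and z: "z \<in> carrier G" "k z \<noteq> 0"
  obtains \<mu>\<^sub>1 \<phi> a a\<^sub>1 a\<^sub>2 where "character G \<mu>\<^sub>1" "a \<noteq> 0"
    "\<And>x y. \<lbrakk>x \<in> carrier G; y \<in> carrier G\<rbrakk> \<Longrightarrow> \<phi> (x \<otimes> y) = \<phi> x * \<mu>\<^sub>1 y + \<mu> x * \<phi> y"
    "\<And>x. x \<in> carrier G \<Longrightarrow> f x = a\<^sub>1 * \<mu> x + \<phi> x"
    "\<And>x. x \<in> carrier G \<Longrightarrow> g x = (\<phi> x - a\<^sub>2 * \<mu> x) / a"
    "\<And>x. x \<in> carrier G \<Longrightarrow> k x = a * \<mu>\<^sub>1 x"
    "\<And>x. x \<in> carrier G \<Longrightarrow> l x = a\<^sub>1 * \<mu> x + a\<^sub>2 * \<mu>\<^sub>1 x + \<phi> x"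
proof -
  define a where "a = k \<one>"
  define b where "b = l \<one>"
  define m where "m = (\<lambda>x. k x / a)"
  \<comment> \<open>The equation wanted for \<open>\<phi>\<close> forces the value 0 at the
    identity; this fixes the multiple of \<open>\<mu>\<close> to subtract.\<close>
  define \<phi> where "\<phi> = (\<lambda>x. f x - f \<one> * \<mu> x)"
  note \<mu>_mult = characterD(2)[OF \<mu>]
  have \<mu>_one: "\<mu> \<one> = 1"
    using character_one[OF \<mu>] .
  have fg: "f x = a * g x + b * \<mu> x" if "x \<in> carrier G" for x
    using eq[of x \<one>] that by (simp add: a_def b_def)
  have "a \<noteq> 0"
  proof
    assume a0: "a = 0"
    \<comment> \<open>If \<open>a = 0\<close>, then \<open>f = b * \<mu>\<close>, and the equation
      at \<open>(x, z)\<close> relates \<open>g\<close> to \<open>\<mu>\<close> with the nonzero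
      coefficient \<open>k z\<close>.\<close>
    have "k z * g x + (l z - b * \<mu> z) * \<mu> x = 0" if "x \<in> carrier G" for x
      using eq[OF that z(1)] fg[of "x \<otimes> z"] \<mu>_mult[OF that z(1)] that z(1) a0
      by (simp add: algebra_simps)
    then show False
      using indep z(2) by blast
  qed
  then have ka: "k x = a * m x" for x
    by (simp add: m_def)
  have m_one: "m \<one> = 1"
    using \<open>a \<noteq> 0\<close> by (simp add: m_def a_def)
  have m_mult: "m (y \<otimes> z) = m y * m z" if y: "y \<in> carrier G" and z: "z \<in> carrier G" for y z
  proof -
    have "(a * m (y \<otimes> z) - a * m y * m z) * g x
        + (l (y \<otimes> z) - (l y - b * \<mu> y) * m z - \<mu> y * l z) * \<mu> x = 0"
      if x: "x \<in> carrier G" for x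
    proof -
      \<comment> \<open>The value \<open>g (x \<otimes> y)\<close> is the only obstacle to comparing
        coefficients in \<open>x\<close>; it is expressed here through \<open>g x\<close> and
        \<open>\<mu> x\<close>, then substituted into the two expansions of f(xyz).\<close>
      have "a * g (x \<otimes> y) = a * g x * m y + \<mu> x * l y - b * \<mu> x * \<mu> y"
        using fg[of "x \<otimes> y"] eq[OF x y] x y by (simp add: ka \<mu>_mult algebra_simps)
      moreover have "a * g (x \<otimes> y) * m z + \<mu> x * \<mu> y * l z = g x * (a * m (y \<otimes> z)) + \<mu> x * l (y \<otimes> z)"
        using eq[of "x \<otimes> y" z] eq[of x "y \<otimes> z"] x y z
        by (simp add: ka \<mu>_mult m_assoc algebra_simps)
      ultimately show ?thesis
        by algebra
    qed
    then have "a * m (y \<otimes> z) - a * m y * m z = 0"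
      by (rule indep)
    then have "a * (m (y \<otimes> z) - m y * m z) = 0"
      by (simp add: algebra_simps)
    then show ?thesis
      using \<open>a \<noteq> 0\<close> by simp
  qed
  \<comment> \<open>Take the first argument to be \<open>\<one>\<close> and use
    \<open>a * g \<one> = f \<one> - b\<close>; thus \<open>b - f \<one>\<close> serves as
    \<open>a\<^sub>2\<close>.\<close>
  have l: "l x = f \<one> * \<mu> x + (b - f \<one>) * m x + \<phi> x" if "x \<in> carrier G" for x
    using eq[of \<one> x] fg[of \<one>] that
    by (simp add: \<phi>_def ka \<mu>_one algebra_simps)
  show thesis
  proof
    show "character G m"
      using m_mult m_one by (rule characterI)
    show "\<phi> (x \<otimes> y) = \<phi> x * m y + \<mu> x * \<phi> y" if "x \<in> carrier G" "y \<in> carrier G" for x y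
      using eq[OF that] fg[of x] l[of y] that
      by (simp add: \<phi>_def ka \<mu>_mult algebra_simps)
    show "g x = (\<phi> x - (b - f \<one>) * \<mu> x) / a" if "x \<in> carrier G" for x
      using fg[OF that] \<open>a \<noteq> 0\<close> by (simp add: \<phi>_def field_simps)
  qed (use \<open>a \<noteq> 0\<close> ka l in \<open>auto simp: \<phi>_def\<close>)
qed

end

section \<open>Linear independence of \<mu>, \<chi> and \<chi>A, and its consequences\<close>

locale distinct_characters_additive = group G for G (structure) +
  fixes \<mu> \<chi> A :: "'a \<Rightarrow> complex"
  assumes \<mu>: "character G \<mu>" and \<chi>: "character G \<chi>"
    and distinct: "\<exists>x\<in>carrier G. \<mu> x \<noteq> \<chi> x"
    and additive: "additive_on_group G A"
    and A_nonzero: "\<exists>x\<in>carrier G. A x \<noteq> 0"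
begin

lemmas \<mu>_mult = characterD(2)[OF \<mu>] and \<chi>_mult = characterD(2)[OF \<chi>]
  and \<mu>_one = character_one[OF \<mu>] and \<chi>_one = character_one[OF \<chi>]

lemma A_mult: "\<lbrakk>x \<in> carrier G; y \<in> carrier G\<rbrakk> \<Longrightarrow> A (x \<otimes> y) = A x + A y"
  using additive by (simp add: additive_on_group_def)

lemma A_one: "A \<one> = 0"
  using A_mult[of \<one> \<one>] by simp

text \<open>Evaluate at the identity, at a point t where \<mu> and \<chi> differ, and at its square.
  As b = -a, the relation at the square minus 2\<chi>(t) times the relation at t leaves a(\<mu>(t) -
  \<chi>(t))^2 = 0.\<close>

lemma independent:
  assumes zero: "\<And>x. x \<in> carrier G \<Longrightarrow> a * \<mu> x + b * \<chi> x + c * \<chi> x * A x = 0"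
  shows "a = 0" "b = 0" "c = 0"
proof -
  obtain s t where s: "s \<in> carrier G" "A s \<noteq> 0" and t: "t \<in> carrier G" "\<mu> t \<noteq> \<chi> t"
    using distinct A_nonzero by blast
  have e1: "a + b = 0"
    using zero[of \<one>] by (simp add: \<mu>_one \<chi>_one A_one)
  have "a * (\<mu> t * \<mu> t) + b * (\<chi> t * \<chi> t) + c * (\<chi> t * \<chi> t) * (A t + A t) = 0"
    using zero[of "t \<otimes> t"] t by (simp add: \<mu>_mult \<chi>_mult A_mult)
  then have "a * ((\<mu> t - \<chi> t) * (\<mu> t - \<chi> t)) = 0"
    using e1 zero[OF t(1)] by algebra
  then show "a = 0"
    using t by simp
  then show "b = 0"
    using e1 by simp
  then show "c = 0"
    using zero[OF s(1)] \<open>a = 0\<close> s characterD(1)[OF \<chi>] by simp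
qed

text \<open>Putting \<open>y = \<one>\<close> places \<open>f\<close> in the span of \<mu>, \<chi>,
  \<chi>A. For fixed \<open>y\<close>, both sides are then combinations of these three functions of
  \<open>x\<close>, and independence determines \<open>k\<close>, \<open>l\<close> and
  \<open>h\<close>.\<close>

lemma spanned_equation:
  assumes eq: "\<And>x y. \<lbrakk>x \<in> carrier G; y \<in> carrier G\<rbrakk> \<Longrightarrow>
      f (x \<otimes> y) = \<chi> x * k y + \<mu> x * l y + \<chi> x * A x * h y"
  obtains q p r where
    "\<And>x. x \<in> carrier G \<Longrightarrow> f x = q * \<mu> x + p * \<chi> x + r * \<chi> x * A x"
    "\<And>x. x \<in> carrier G \<Longrightarrow> k x = p * \<chi> x + r * \<chi> x * A x"
    "\<And>x. x \<in> carrier G \<Longrightarrow> l x = q * \<mu> x"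
    "\<And>x. x \<in> carrier G \<Longrightarrow> h x = r * \<chi> x"
proof -
  define p q r where "p = k \<one>" and "q = l \<one>" and "r = h \<one>"
  have f: "f x = q * \<mu> x + p * \<chi> x + r * \<chi> x * A x" if "x \<in> carrier G" for x
    using eq[of x \<one>] that by (simp add: p_def q_def r_def)
  have zero: "(q * \<mu> y - l y) * \<mu> x + (p * \<chi> y + r * \<chi> y * A y - k y) * \<chi> x
      + (r * \<chi> y - h y) * \<chi> x * A x = 0"
    if "x \<in> carrier G" "y \<in> carrier G" for x y
    using eq[OF that] f[of "x \<otimes> y"] that
    by (simp add: \<mu>_mult \<chi>_mult A_mult algebra_simps)
  show thesis
  proof (rule that[OF f])
    show "k y = p * \<chi> y + r * \<chi> y * A y" "l y = q * \<mu> y" "h y = r * \<chi> y"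
      if "y \<in> carrier G" for y
      using independent[OF zero[OF _ that]] by simp_all
  qed
qed

text \<open>Expand f(xsw) in two ways for w = y and w = z, and cross-multiply by \<open>k z\<close>
  and \<open>k y\<close> to cancel the unknown \<open>g (x \<otimes> s)\<close>. Because A(xs) =
  A(x) + A(s), the coefficient of \<chi>(x) in what remains is \<open>\<chi> s * A s\<close> times
  the difference that has to vanish; hence the choice of \<open>s\<close> with \<open>A s\<close>
  nonzero.\<close>

lemma proportional_if_independent:
  assumes eq: "\<And>x y. \<lbrakk>x \<in> carrier G; y \<in> carrier G\<rbrakk> \<Longrightarrow>
      f (x \<otimes> y) = g x * k y + \<mu> x * l y + \<chi> x * A x * h y"
    and indep: "\<nexists>a b c. \<forall>x\<in>carrier G. g x = a * \<mu> x + b * \<chi> x + c * \<chi> x * A x"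
    and yz: "y \<in> carrier G" "z \<in> carrier G"
  shows "h y * k z = h z * k y"
proof -
  obtain s where s: "s \<in> carrier G" "A s \<noteq> 0"
    using A_nonzero by blast
  have coeffs: "p = 0" if "\<And>x. x \<in> carrier G \<Longrightarrow> p * g x + a * \<mu> x + b * \<chi> x + c * \<chi> x * A x = 0"
    for p a b c
  proof (rule ccontr)
    assume "p \<noteq> 0"
    then have "g x = - a / p * \<mu> x + - b / p * \<chi> x + - c / p * \<chi> x * A x" if "x \<in> carrier G" for x
      using \<open>\<And>x. x \<in> carrier G \<Longrightarrow> p * g x + a * \<mu> x + b * \<chi> x + c * \<chi> x * A x = 0\<close>[OF that]
      by (simp add: field_simps) algebra
    then show False
      using indep by blast
  qed
  \<comment> \<open>\<open>P\<close>, \<open>Q\<close>, \<open>S\<close>, \<open>R\<close> are the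
    coefficients of \<open>g\<close>, \<open>\<mu>\<close>, \<open>\<chi>\<close>,
    \<open>\<chi> A\<close> after the cross-multiplication.\<close>
  define P where "P = k (s \<otimes> z) * k y - k (s \<otimes> y) * k z"
  define Q where "Q = (l (s \<otimes> z) - \<mu> s * l z) * k y - (l (s \<otimes> y) - \<mu> s * l y) * k z"
  define R where "R = (h (s \<otimes> z) - \<chi> s * h z) * k y - (h (s \<otimes> y) - \<chi> s * h y) * k z"
  define S where "S = \<chi> s * A s * (h y * k z - h z * k y)"
  have zero: "P * g x + Q * \<mu> x + S * \<chi> x + R * \<chi> x * A x = 0" if x: "x \<in> carrier G" for x
  proof -
    have assoc: "g (x \<otimes> s) * k w + \<mu> x * \<mu> s * l w + \<chi> x * \<chi> s * (A x + A s) * h w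
        = g x * k (s \<otimes> w) + \<mu> x * l (s \<otimes> w) + \<chi> x * A x * h (s \<otimes> w)"
      if "w \<in> carrier G" for w
      using eq[of "x \<otimes> s" w] eq[of x "s \<otimes> w"] x s that
      by (simp add: \<mu>_mult \<chi>_mult A_mult m_assoc)
    show ?thesis
      using assoc[OF yz(1)] assoc[OF yz(2)] unfolding P_def Q_def R_def S_def by algebra
  qed
  have "P = 0"
    using zero by (rule coeffs)
  then have "S = 0"
    using zero by (intro independent(2)[of Q S R]) simp
  then show ?thesis
    using s characterD(1)[OF \<chi>] by (simp add: S_def)
qed

end

section \<open>Classification of the solutions\<close>

theorem theorem7p2:
  fixes G :: "('a, 'b) monoid_scheme" (structure)
    and \<mu> \<chi> A f g\<^sub>1 h\<^sub>1 h\<^sub>2 h :: "'a \<Rightarrow> complex"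
  assumes "group G"
    and "character G \<mu>" and "character G \<chi>"
    and "\<exists>x\<in>carrier G. \<mu> x \<noteq> \<chi> x"
    and "additive_on_group G A"
    and "\<exists>x\<in>carrier G. A x \<noteq> 0"
  shows
    "(\<forall>x\<in>carrier G. \<forall>y\<in>carrier G.
        f (x \<otimes> y) = g\<^sub>1 x * h\<^sub>1 y + \<mu> x * h\<^sub>2 y + \<chi> x * A x * h y)
     \<longleftrightarrow>
     (\<exists>a. \<forall>x\<in>carrier G.
        f x = a * \<mu> x \<and>
        h\<^sub>1 x = 0 \<and>
        h\<^sub>2 x = a * \<mu> x \<and>
        h x = 0)
     \<or>
     (\<exists>a b c. (\<exists>x\<in>carrier G. h\<^sub>1 x \<noteq> 0) \<and>
       (\<forall>x\<in>carrier G.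
        f x = a * \<mu> x \<and>
        g\<^sub>1 x = - b * \<mu> x + c * \<chi> x * A x \<and>
        h\<^sub>2 x = a * \<mu> x + b * h\<^sub>1 x \<and>
        h x = - c * h\<^sub>1 x))
     \<or>
     (\<exists>a \<alpha> \<beta> \<gamma> b c. \<beta> * b * c \<noteq> 0 \<and> b = \<beta> * c \<and>
       (\<forall>x\<in>carrier G.
        f x = a * \<mu> x + b * \<chi> x * A x \<and>
        g\<^sub>1 x = \<alpha> * \<mu> x + \<beta> * \<chi> x + \<gamma> * \<chi> x * A x \<and>
        h\<^sub>1 x = c * \<chi> x * A x \<and>
        h\<^sub>2 x = a * \<mu> x - \<alpha> * c * \<chi> x * A x \<and>
        h x = b * \<chi> x - \<gamma> * c * \<chi> x * A x))
     \<or>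
     (\<exists>\<mu>\<^sub>1 \<phi> a a\<^sub>1 a\<^sub>2 a\<^sub>3. character G \<mu>\<^sub>1 \<and> a \<noteq> 0 \<and>
       (\<forall>x\<in>carrier G. \<forall>y\<in>carrier G. \<phi> (x \<otimes> y) = \<phi> x * \<mu>\<^sub>1 y + \<mu> x * \<phi> y) \<and>
       (\<forall>x\<in>carrier G.
        f x = a\<^sub>1 * \<mu> x + \<phi> x \<and>
        g\<^sub>1 x = (\<phi> x - a\<^sub>2 * \<mu> x) / a + a\<^sub>3 * \<chi> x * A x \<and>
        h\<^sub>1 x = a * \<mu>\<^sub>1 x \<and>
        h\<^sub>2 x = a\<^sub>1 * \<mu> x + a\<^sub>2 * \<mu>\<^sub>1 x + \<phi> x \<and>
        h x = - a * a\<^sub>3 * \<mu>\<^sub>1 x))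
     \<or>
     (\<exists>\<alpha> a a\<^sub>1 a\<^sub>2 a\<^sub>3 c. c \<noteq> 0 \<and> a\<^sub>2 \<noteq> 0 \<and>
       (\<forall>x\<in>carrier G.
        f x = a * \<mu> x + c * a\<^sub>2 * \<chi> x + \<alpha> * c * a\<^sub>2 * \<chi> x * A x \<and>
        g\<^sub>1 x = a\<^sub>1 * \<mu> x + a\<^sub>2 * \<chi> x + a\<^sub>3 * \<chi> x * A x \<and>
        h\<^sub>1 x = c * \<chi> x + \<alpha> * c * \<chi> x * A x \<and>
        h\<^sub>2 x = a * \<mu> x - c * a\<^sub>1 * \<chi> x - \<alpha> * c * a\<^sub>1 * \<chi> x * A x \<and>
        h x = c * (\<alpha> * a\<^sub>2 - a\<^sub>3) * \<chi> x - \<alpha> * c * a\<^sub>3 * \<chi> x * A x))"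
  (is "?E \<longleftrightarrow> ?F1 \<or> ?F2 \<or> ?F3 \<or> ?F4 \<or> ?F5")
proof
  interpret distinct_characters_additive G \<mu> \<chi> A
    using assms by (intro distinct_characters_additive.intro distinct_characters_additive_axioms.intro)
  assume E: ?E
  show "?F1 \<or> ?F2 \<or> ?F3 \<or> ?F4 \<or> ?F5"
  proof (cases "\<forall>x\<in>carrier G. h\<^sub>1 x = 0")
    case True
    \<comment> \<open>Without its first term the equation has the spanned shape with
      \<open>k = 0\<close>, so independence removes \<open>p\<close> and \<open>r\<close>.\<close>
    have eq: "f (x \<otimes> y) = \<chi> x * 0 + \<mu> x * h\<^sub>2 y + \<chi> x * A x * h y"
      if "x \<in> carrier G" "y \<in> carrier G" for x y
      using E True that by simp
    obtain q p r where pqr: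
      "\<And>x. x \<in> carrier G \<Longrightarrow> f x = q * \<mu> x + p * \<chi> x + r * \<chi> x * A x"
      "\<And>x. x \<in> carrier G \<Longrightarrow> 0 = p * \<chi> x + r * \<chi> x * A x"
      "\<And>x. x \<in> carrier G \<Longrightarrow> h\<^sub>2 x = q * \<mu> x"
      "\<And>x. x \<in> carrier G \<Longrightarrow> h x = r * \<chi> x"
      by (rule spanned_equation[where f = f and k = "\<lambda>_. 0", OF eq]) blast+
    have "p = 0" "r = 0"
      using independent[of 0 p r] pqr(2) by simp_all
    then have ?F1
      using pqr True by auto
    then show ?thesis
      by (rule disjI1)
  next
    case False
    then obtain z where z: "z \<in> carrier G" "h\<^sub>1 z \<noteq> 0"
      by blast
    show ?thesis
    proof (cases "\<exists>a b c. \<forall>x\<in>carrier G. g\<^sub>1 x = a * \<mu> x + b * \<chi> x + c * \<chi> x * A x")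
      case True
      then obtain a\<^sub>1 a\<^sub>2 a\<^sub>3 where g:
        "\<And>x. x \<in> carrier G \<Longrightarrow> g\<^sub>1 x = a\<^sub>1 * \<mu> x + a\<^sub>2 * \<chi> x + a\<^sub>3 * \<chi> x * A x"
        by blast
      \<comment> \<open>Distribute the expansion of \<open>g\<^sub>1\<close> and collect the factors
        of \<mu>, \<chi> and \<chi>A.\<close>
      have eq: "f (x \<otimes> y) = \<chi> x * (a\<^sub>2 * h\<^sub>1 y) + \<mu> x * (h\<^sub>2 y + a\<^sub>1 * h\<^sub>1 y) + \<chi> x * A x * (h y + a\<^sub>3 * h\<^sub>1 y)"
        if "x \<in> carrier G" "y \<in> carrier G" for x y
        using E g that by (simp add: algebra_simps)
      obtain q p r where pqr:
        "\<And>x. x \<in> carrier G \<Longrightarrow> f x = q * \<mu> x + p * \<chi> x + r * \<chi> x * A x"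
        "\<And>x. x \<in> carrier G \<Longrightarrow> a\<^sub>2 * h\<^sub>1 x = p * \<chi> x + r * \<chi> x * A x"
        "\<And>x. x \<in> carrier G \<Longrightarrow> h\<^sub>2 x + a\<^sub>1 * h\<^sub>1 x = q * \<mu> x"
        "\<And>x. x \<in> carrier G \<Longrightarrow> h x + a\<^sub>3 * h\<^sub>1 x = r * \<chi> x"
        by (rule spanned_equation[where f = f and k = "\<lambda>y. a\<^sub>2 * h\<^sub>1 y", OF eq]) blast+
      have h2: "h\<^sub>2 x = q * \<mu> x - a\<^sub>1 * h\<^sub>1 x" and h: "h x = r * \<chi> x - a\<^sub>3 * h\<^sub>1 x"
        if "x \<in> carrier G" for x
        using pqr(3,4)[OF that] by (simp_all add: algebra_simps)
      show ?thesis
      proof (cases "a\<^sub>2 = 0")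
        case True
        \<comment> \<open>With \<open>a\<^sub>2 = 0\<close> the \<chi>-coefficient no longer
          constrains \<open>h\<^sub>1\<close>, which therefore stays arbitrary.\<close>
        have pr: "p = 0" "r = 0"
          using independent[of 0 p r] pqr(2) True by simp_all
        have ?F2
          by (rule exI[of _ q], rule exI[of _ "- a\<^sub>1"], rule exI[of _ a\<^sub>3])
            (use z in \<open>auto simp: pqr(1) pr g h2 h True\<close>)
        then show ?thesis
          by (rule disjI2[OF disjI1])
      next
        case a2: False
        have h1: "h\<^sub>1 x = (p / a\<^sub>2) * \<chi> x + (r / a\<^sub>2) * \<chi> x * A x" if "x \<in> carrier G" for x
          using pqr(2)[OF that] a2 by (simp add: field_simps)
        show ?thesis
        proof (cases "p = 0")
          case True
          \<comment> \<open>Here \<open>h\<^sub>1\<close> is \<open>r / a\<^sub>2\<close> times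
            \<chi>A; it is not the zero function, so the constants of \<open>?F3\<close> are
            nonzero.\<close>
          have "r \<noteq> 0"
            using h1[OF z(1)] z(2) True by auto
          have ?F3
            by (rule exI[of _ q], rule exI[of _ a\<^sub>1], rule exI[of _ a\<^sub>2],
                rule exI[of _ a\<^sub>3], rule exI[of _ r], rule exI[of _ "r / a\<^sub>2"],
                intro conjI ballI)
              (simp_all add: \<open>r \<noteq> 0\<close> a2 True pqr(1) g h1 h2 h algebra_simps)
          then show ?thesis
            by (rule disjI2[OF disjI2[OF disjI1]])
        next
          case False
          \<comment> \<open>Normalise \<open>h\<^sub>1\<close> by its \<chi>-coefficient
            \<open>c\<close>; then \<alpha> is the ratio of the \<chi>A-coefficient to it.\<close>
          define c \<alpha> where "c = p / a\<^sub>2" and "\<alpha> = r / p"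
          have "c \<noteq> 0" and p: "p = c * a\<^sub>2" and r: "r = \<alpha> * c * a\<^sub>2"
            using False a2 by (simp_all add: c_def \<alpha>_def)
          have h1': "h\<^sub>1 x = c * \<chi> x + \<alpha> * c * \<chi> x * A x" if "x \<in> carrier G" for x
            using h1[OF that] a2 by (simp add: p r)
          have ?F5
            by (rule exI[of _ \<alpha>], rule exI[of _ q], rule exI[of _ a\<^sub>1],
                rule exI[of _ a\<^sub>2], rule exI[of _ a\<^sub>3], rule exI[of _ c],
                intro conjI ballI)
              (simp_all add: \<open>c \<noteq> 0\<close> a2 pqr(1) g h1' h2 h p r algebra_simps)
          then show ?thesis
            by (rule disjI2[OF disjI2[OF disjI2[OF disjI2]]])
        qed
      qed
    next
      case not_spanned: False
      define c where "c = - h z / h\<^sub>1 z"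
      have "h x * h\<^sub>1 z = h z * h\<^sub>1 x" if "x \<in> carrier G" for x
        by (rule proportional_if_independent[OF E[rule_format] not_spanned that z(1)])
      then have h: "h x = - c * h\<^sub>1 x" if "x \<in> carrier G" for x
        using that z(2) by (simp add: c_def field_simps)
      \<comment> \<open>As \<open>h = - c * h\<^sub>1\<close>, subtracting \<open>c\<close> times
        \<chi>A from \<open>g\<^sub>1\<close> absorbs the last term of the equation;
        \<open>c\<close> becomes \<open>a\<^sub>3\<close> in \<open>?F4\<close>.\<close>
      define g where "g = (\<lambda>x. g\<^sub>1 x - c * \<chi> x * A x)"
      have eq: "f (x \<otimes> y) = g x * h\<^sub>1 y + \<mu> x * h\<^sub>2 y" if "x \<in> carrier G" "y \<in> carrier G" for x y
        using E h that by (simp add: g_def algebra_simps)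
      have indep: "p = 0" if zero: "\<And>x. x \<in> carrier G \<Longrightarrow> p * g x + q * \<mu> x = 0" for p q
      proof (rule ccontr)
        assume "p \<noteq> 0"
        \<comment> \<open>If \<open>g\<close> were a multiple of \<mu>, then
          \<open>g\<^sub>1\<close> would lie in the excluded span, with \<chi>-coefficient
          0.\<close>
        then have "g\<^sub>1 x = - q / p * \<mu> x + 0 * \<chi> x + c * \<chi> x * A x" if "x \<in> carrier G" for x
          using zero[OF that] by (simp add: g_def field_simps)
        then show False
          using not_spanned by blast
      qed
      obtain \<mu>\<^sub>1 \<phi> a a\<^sub>1 a\<^sub>2 where form4:
        "character G \<mu>\<^sub>1" "a \<noteq> 0"
        "\<And>x y. \<lbrakk>x \<in> carrier G; y \<in> carrier G\<rbrakk> \<Longrightarrow> \<phi> (x \<otimes> y) = \<phi> x * \<mu>\<^sub>1 y + \<mu> x * \<phi> y"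
        "\<And>x. x \<in> carrier G \<Longrightarrow> f x = a\<^sub>1 * \<mu> x + \<phi> x"
        "\<And>x. x \<in> carrier G \<Longrightarrow> g x = (\<phi> x - a\<^sub>2 * \<mu> x) / a"
        "\<And>x. x \<in> carrier G \<Longrightarrow> h\<^sub>1 x = a * \<mu>\<^sub>1 x"
        "\<And>x. x \<in> carrier G \<Longrightarrow> h\<^sub>2 x = a\<^sub>1 * \<mu> x + a\<^sub>2 * \<mu>\<^sub>1 x + \<phi> x"
        by (rule two_term_equation[OF \<mu> eq indep z]) blast+
      have "g\<^sub>1 x = g x + c * \<chi> x * A x" for x
        by (simp add: g_def)
      then have g: "g\<^sub>1 x = (\<phi> x - a\<^sub>2 * \<mu> x) / a + c * \<chi> x * A x" if "x \<in> carrier G" for x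
        using form4(5)[OF that] by simp
      have ?F4
        by (rule exI[of _ \<mu>\<^sub>1], rule exI[of _ \<phi>], rule exI[of _ a],
            rule exI[of _ a\<^sub>1], rule exI[of _ a\<^sub>2], rule exI[of _ c],
            intro conjI ballI)
          (simp_all add: form4(1-4,6,7) g h)
      then show ?thesis
        by (rule disjI2[OF disjI2[OF disjI2[OF disjI1]]])
    qed
  qed
next
  interpret distinct_characters_additive G \<mu> \<chi> A
    using assms by (intro distinct_characters_additive.intro distinct_characters_additive_axioms.intro)
  note mult = \<mu>_mult \<chi>_mult A_mult
  assume "?F1 \<or> ?F2 \<or> ?F3 \<or> ?F4 \<or> ?F5"
  then show ?E
  proof (elim disjE)
    assume ?F1
    then show ?E
      by (auto simp: mult)
  next
    assume ?F2
    then show ?E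
      by (elim exE conjE) (simp add: mult, simp add: algebra_simps)
  next
    assume ?F3
    then show ?E
      by (elim exE conjE) (simp add: mult, simp add: algebra_simps)
  next
    \<comment> \<open>Here \<phi>(xy) is expanded by the equation assumed for \<phi>, and
      \<open>a \<noteq> 0\<close> lets the denominator of \<open>g\<^sub>1\<close> cancel against
      \<open>h\<^sub>1\<close>.\<close>
    assume ?F4
    then show ?E
      by (elim exE conjE) (simp add: mult, simp add: field_simps)
  next
    assume ?F5
    then show ?E
      by (elim exE conjE) (simp add: mult, simp add: algebra_simps)
  qed
qed

end
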